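(* Let $m\in\mathbb{N}^*$ and $p\in[0,1]$, and let $(G_t)_{t\ge 1}$ be the PA-APA random graph process with parameters $m$ and $p$. For $t\ge 1$ and $k\ge m$ let $P(k,t)=\mathbb{E}[N_k(t)/t]$ be the expected proportion of vertices of $G_t$ having degree $k$, where $N_k(t)=\sum_{j=1}^{t}\mathbf{1}_{\{d(v_j,t)=k\}}$. Then for every integer $k\ge m$ the limit $P(k)=\lim_{t\to\infty}P(k,t)$ exists, and it is given as follows. If $p\in[0,1)$, then $$P(k)=\frac{2}{2+m+mp}\cdot\frac{\xi(k)}{\xi(m)},\qquad k\ge m,$$ where $$\xi(k)=\frac{\Gamma\left(k+\frac{2mp}{1-p}\right)}{\Gamma\left(k+1+\frac{2(mp+1)}{1-p}\right)}$$ and $\Gamma$ is Euler's Gamma function. If $p=1$, then $$P(k)=\frac{1}{m+1}\left(1-\frac{1}{m+1}\right)^{k-m},\qquad k\ge m.$$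
   Context: $\mathbb{N}^*=\{1,2,\dots\}$. The PA-APA random graph process with parameters $m\in\mathbb{N}^*$ and $p\in[0,1]$ is the following sequence $(G_t)_{t\ge1}$ of random undirected multigraphs, where $G_t$ has vertices $v_1,\dots,v_t$ and $mt$ edges. Let $d(v_i,t)$ denote the degree of $v_i$ in $G_t$ for $t\ge i$ (multiple edges are counted with multiplicity, and a self-loop contributes $2$), and $d(v_i,t)=0$ for $t<i$. Let $\mathcal{F}_t=\sigma(G_s: 1\le s\le t)$. $G_1$ consists of the single vertex $v_1$ with $m$ self-loops (so $d(v_1,1)=2m$). Let $(Y_t)_{t\ge2}$ be i.i.d. Bernoulli random variables with $\mathbb{P}(Y_t=1)=p$, with $Y_{t+1}$ independent of $\mathcal{F}_t$ for each $t\ge 1$. For each $t\ge1$, $G_{t+1}$ is obtained from $G_t$ by adding a new vertex $v_{t+1}$ and $m$ edges joining $v_{t+1}$ to vertices $W_{t+1}^1,\dots,W_{t+1}^m\in\{v_1,\dots,v_t\}$ (repetitions allowed, giving multiple edges). Given $\mathcal{F}_t$ and $Y_{t+1}$, these $m$ vertices are chosen independently, each according to: if $Y_{t+1}=0$ (preferential attachment), $v_i$ is chosen with probability $\frac{d(v_i,t)}{2mt}$, $1\le i\le t$; if $Y_{t+1}=1$ (anti-preferential attachment), $v_i$ is chosen with probability $\frac{2mt+1-d(v_i,t)}{t(2mt+1-2m)}$, $1\le i\le t$. *)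

theory Defs
  imports "HOL-Probability.Probability" "HOL-Library.Uprod"
begin

(* The vertex v_i is represented by its index i.  An edge is an unordered pair; a self-loop at v
   is Upair v v. *)

datatype multigraph = Multigraph (verts: "nat set") (edges: "nat uprod multiset")

(* The second summand makes a self-loop contribute 2.  A vertex that does not occur in the graph
   has degree 0. *)
definition degree :: "multigraph \<Rightarrow> nat \<Rightarrow> nat" where
  "degree G v = size {#e \<in># edges G. v \<in> set_uprod e#} + size {#e \<in># edges G. e = Upair v v#}"

definition initial_graph :: "nat \<Rightarrow> multigraph" where
  "initial_graph m = Multigraph {1} (replicate_mset m (Upair 1 1))"

definition attach_vertex :: "nat \<Rightarrow> nat \<Rightarrow> (nat \<Rightarrow> nat) \<Rightarrow> multigraph \<Rightarrow> multigraph" where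
  "attach_vertex m v w G =
     Multigraph (insert v (verts G)) (edges G + {#Upair v (w j). j \<in># mset_set {1..m}#})"

(* Probability that a given one of the m edges chooses a vertex of degree d of G_t; y = True is
   the anti-preferential case Y = 1, y = False the preferential case Y = 0. *)
definition attach_prob :: "nat \<Rightarrow> nat \<Rightarrow> bool \<Rightarrow> nat \<Rightarrow> real" where
  "attach_prob m t y d =
     (if y then (2 * real m * real t + 1 - real d) / (real t * (2 * real m * real t + 1 - 2 * real m))
      else real d / (2 * real m * real t))"

definition graph_history :: "'a measure \<Rightarrow> (nat \<Rightarrow> 'a \<Rightarrow> multigraph) \<Rightarrow> nat \<Rightarrow> 'a measure" where
  "graph_history M G t = sigma (space M) {G s -` A \<inter> space M | s A. s \<in> {1..t}}"

definition coin_events :: "'a measure \<Rightarrow> ('a \<Rightarrow> bool) \<Rightarrow> 'a set set" where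
  "coin_events M Z = {Z -` B \<inter> space M | B. True}"

definition history_with_coin ::
    "'a measure \<Rightarrow> (nat \<Rightarrow> 'a \<Rightarrow> multigraph) \<Rightarrow> (nat \<Rightarrow> 'a \<Rightarrow> bool) \<Rightarrow> nat \<Rightarrow> 'a measure" where
  "history_with_coin M G Y t =
     sigma (space M) (sets (graph_history M G t) \<union> coin_events M (Y (Suc t)))"

(* G t is the graph G_t, Y t the coin Y_t, and W t j the endpoint W_t^j.  The values of G at 0,
   of Y at t < 2, and of W at t < 2 or j outside {1..m} are irrelevant. *)
locale pa_apa = prob_space M
  for M :: "'a measure" and m :: nat and p :: real
    and G :: "nat \<Rightarrow> 'a \<Rightarrow> multigraph"
    and Y :: "nat \<Rightarrow> 'a \<Rightarrow> bool"
    and W :: "nat \<Rightarrow> nat \<Rightarrow> 'a \<Rightarrow> nat" +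
  assumes Y_indep: "indep_vars (\<lambda>_. count_space UNIV) Y {2..}"
    and Y_distr: "\<And>t. t \<ge> 2 \<Longrightarrow> distr M (count_space UNIV) (Y t) = measure_pmf (bernoulli_pmf p)"
    and Y_indep_past:
      "\<And>t. t \<ge> 1 \<Longrightarrow> indep_set (sets (graph_history M G t)) (coin_events M (Y (Suc t)))"
    and W_measurable:
      "\<And>t j. t \<ge> 1 \<Longrightarrow> j \<in> {1..m} \<Longrightarrow> random_variable (count_space UNIV) (W (Suc t) j)"
    and W_range:
      "\<And>t j \<omega>. t \<ge> 1 \<Longrightarrow> j \<in> {1..m} \<Longrightarrow> \<omega> \<in> space M \<Longrightarrow> W (Suc t) j \<omega> \<in> {1..t}"
    and G_1: "\<And>\<omega>. \<omega> \<in> space M \<Longrightarrow> G 1 \<omega> = initial_graph m"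
    and G_Suc:
      "\<And>t \<omega>. t \<ge> 1 \<Longrightarrow> \<omega> \<in> space M \<Longrightarrow>
         G (Suc t) \<omega> = attach_vertex m (Suc t) (\<lambda>j. W (Suc t) j \<omega>) (G t \<omega>)"
    (* The product is the joint law of conditionally independent choices. *)
    and W_cond:
      "\<And>t v. t \<ge> 1 \<Longrightarrow> v \<in> {1..m} \<rightarrow> {1..t} \<Longrightarrow>
         AE \<omega> in M. real_cond_exp M (history_with_coin M G Y t)
             (indicator {\<omega> \<in> space M. \<forall>j\<in>{1..m}. W (Suc t) j \<omega> = v j}) \<omega>
           = (\<Prod>j\<in>{1..m}. attach_prob m t (Y (Suc t) \<omega>) (degree (G t \<omega>) (v j)))"

definition num_degree :: "(nat \<Rightarrow> 'a \<Rightarrow> multigraph) \<Rightarrow> nat \<Rightarrow> nat \<Rightarrow> 'a \<Rightarrow> real" where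
  "num_degree G k t \<omega> = (\<Sum>j=1..t. of_bool (degree (G t \<omega>) j = k))"

definition expected_proportion ::
    "'a measure \<Rightarrow> (nat \<Rightarrow> 'a \<Rightarrow> multigraph) \<Rightarrow> nat \<Rightarrow> nat \<Rightarrow> real" where
  "expected_proportion M G k t = (\<integral>\<omega>. num_degree G k t \<omega> / real t \<partial>M)"

definition xi :: "nat \<Rightarrow> real \<Rightarrow> nat \<Rightarrow> real" where
  "xi m p k = Gamma (real k + 2 * real m * p / (1 - p))
            / Gamma (real k + 1 + 2 * (real m * p + 1) / (1 - p))"

end

theory Submission
  imports Defs "HOL-Real_Asymp.Real_Asymp"
begin

text \<open>
  Only the expected degree counts \<open>e k t = E (N k t)\<close> matter.  Conditionally on the graph at time
  \<open>t\<close> and on the coin, the number of the \<open>m\<close> new edges that hit a fixed vertex of degree \<open>d\<close> is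
  binomial, with a success probability that depends on \<open>d\<close>, \<open>t\<close> and the coin alone; this uses that
  the degrees sum to \<open>2 m t\<close>, so that the attachment weights sum to 1.  The coin is independent of
  the past, so with the coin-averaged binomial weights \<open>\<beta>\<close> (\<open>degree_kernel\<close>) there is the exact
  linear recursion (\<open>expected_count_Suc\<close>)
  \<open>e k (t + 1) = (\<Sum>r\<le>k. \<beta> t (k - r) r * e (k - r) t) + [k = m]\<close>.

  Each success probability is of order \<open>1 / t\<close>.  Hence, as \<open>t\<close> tends to infinity,
  \<open>t (1 - \<beta> t d 0)\<close> and \<open>t \<beta> t d 1\<close> tend to the rate \<open>c d = m p + (1 - p) d / 2\<close>, while
  \<open>t \<beta> t d r\<close> tends to 0 for \<open>r \<ge> 2\<close>.  By strong induction on \<open>k\<close> the recursion becomes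
  \<open>a (t + 1) = (1 - b t / t) a t + g t\<close> with convergent \<open>b\<close> and \<open>g\<close>, and for these
  \<open>a t / t\<close> tends to \<open>lim g / (1 + lim b)\<close> (\<open>linear_recurrence_average_tendsto\<close>).  So the limits
  \<open>P k\<close> exist and satisfy \<open>P k = (c (k - 1) P (k - 1) + [k = m]) / (1 + c k)\<close>.  For \<open>p < 1\<close> the
  ratio \<open>c (k - 1) / (1 + c k)\<close> is \<open>\<xi> k / \<xi> (k - 1)\<close> by the functional equation of the Gamma
  function; for \<open>p = 1\<close> it is the constant \<open>m / (m + 1)\<close>.
\<close>

section \<open>Linear recursions with coefficients of order 1/t\<close>

text \<open>
  From some time on the factors \<open>1 - (1 + b t) / (t + 1)\<close> lie between 0 and \<open>1 - 1 / (2 (t + 1))\<close>.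
  The products of the latter tend to 0, so the iterates forget their start, and the perturbation
  \<open>h t / (t + 1)\<close> is too small to keep them away from 0.
\<close>

lemma affine_step_tendsto:
  fixes x :: "nat \<Rightarrow> real"
  assumes step: "\<And>t. t \<ge> 1 \<Longrightarrow> x (Suc t) = (1 - (1 + b t) / (real t + 1)) * x t + h t / (real t + 1)"
    and b: "b \<longlonglongrightarrow> \<beta>" and "\<beta> \<ge> 0" and h: "h \<longlonglongrightarrow> 0"
  shows "x \<longlonglongrightarrow> 0"
proof (rule LIMSEQ_I)
  fix r :: real assume "r > 0"
  define e where "e = r / 2"
  have "e > 0" using \<open>r > 0\<close> by (simp add: e_def)
  have "\<forall>\<^sub>F t in sequentially. b t > -1/2"
    using order_tendstoD(1)[OF b, of "-1/2"] \<open>\<beta> \<ge> 0\<close> by simp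
  moreover have "\<forall>\<^sub>F t in sequentially. b t < \<beta> + 1"
    using order_tendstoD(2)[OF b, of "\<beta> + 1"] by simp
  moreover have "\<forall>\<^sub>F t in sequentially. \<bar>h t\<bar> < e / 2"
    using order_tendstoD(2)[OF tendsto_rabs[OF h], of "e/2"] \<open>e > 0\<close> by simp
  moreover have "\<forall>\<^sub>F t in sequentially. real t \<ge> \<beta> + 1"
    using eventually_ge_at_top by (simp add: eventually_sequentially) (meson le_trans of_nat_le_iff real_arch_simple order_trans)
  ultimately have "\<forall>\<^sub>F t in sequentially. b t > -1/2 \<and> \<bar>h t\<bar> < e / 2 \<and> 1 + b t \<le> real t + 1 \<and> t \<ge> 1"
    using eventually_ge_at_top[of 1] by eventually_elim auto
  then obtain T where T: "\<And>t. t \<ge> T \<Longrightarrow> b t > -1/2 \<and> \<bar>h t\<bar> < e / 2 \<and> 1 + b t \<le> real t + 1 \<and> t \<ge> 1"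
    unfolding eventually_sequentially by blast
  \<comment> \<open>From time \<open>T\<close> on, the positive part of \<open>\<bar>x t\<bar> - e\<close> shrinks at least by the factor
    \<open>1 - 1 / (2 (t + 1))\<close> in each step, so it decays at least like \<open>1 / sqrt (t + 1)\<close>.\<close>
  define y where "y t = max 0 (\<bar>x t\<bar> - e)" for t
  have y_step: "y (Suc t) * sqrt (real (Suc t) + 1) \<le> y t * sqrt (real t + 1)" if "t \<ge> T" for t
  proof -
    define u where "u = 1 / (real t + 1)"
    have u: "0 < u" "u \<le> 1" by (auto simp: u_def)
    note Tt = T[OF that]
    have "(1 + b t) * u \<le> (real t + 1) * u" using Tt u by (intro mult_right_mono) auto
    hence le1: "(1 + b t) * u \<le> 1" by (simp add: u_def)
    have ge: "(1 + b t) * u \<ge> u / 2" using Tt u mult_right_mono[of "1/2" "1 + b t" u] by simp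
    have "x (Suc t) = (1 - (1 + b t) * u) * x t + h t * u"
      using step[of t] Tt by (simp add: u_def)
    hence "\<bar>x (Suc t)\<bar> \<le> \<bar>(1 - (1 + b t) * u) * x t\<bar> + \<bar>h t * u\<bar>" by linarith
    also have "\<dots> = (1 - (1 + b t) * u) * \<bar>x t\<bar> + \<bar>h t\<bar> * u"
      using le1 u by (simp add: abs_mult)
    also have "\<dots> \<le> (1 - u / 2) * \<bar>x t\<bar> + (e / 2) * u"
      using ge Tt u by (intro add_mono mult_right_mono) auto
    also have "\<dots> = (1 - u / 2) * (\<bar>x t\<bar> - e) + e" by (simp add: field_simps)
    finally have "\<bar>x (Suc t)\<bar> - e \<le> (1 - u / 2) * (\<bar>x t\<bar> - e)" by simp
    also have "\<dots> \<le> (1 - u / 2) * y t" using u by (intro mult_left_mono) (auto simp: y_def)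
    finally have 1: "y (Suc t) \<le> (1 - u / 2) * y t" using u by (auto simp: y_def)
    have "(1 - u/2)\<^sup>2 * (1 + u) = 1 - u\<^sup>2 * (3 - u) / 4" by (simp add: power2_eq_square field_simps)
    also have "\<dots> \<le> 1" using u by simp
    finally have "(1 - u/2)\<^sup>2 * (1 + u) \<le> 1" .
    hence "sqrt ((1 - u/2)\<^sup>2 * (1 + u)) \<le> 1" by simp
    hence 2: "(1 - u/2) * sqrt (1 + u) \<le> 1" using u by (simp add: real_sqrt_mult)
    have eq: "real (Suc t) + 1 = (1 + u) * (real t + 1)" by (simp add: u_def field_simps)
    have "y (Suc t) * sqrt (real (Suc t) + 1) \<le> ((1 - u / 2) * y t) * sqrt (real (Suc t) + 1)"
      using 1 by (intro mult_right_mono) auto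
    also have "\<dots> = ((1 - u/2) * sqrt (1 + u)) * (y t * sqrt (real t + 1))"
      unfolding eq real_sqrt_mult by simp
    also have "\<dots> \<le> 1 * (y t * sqrt (real t + 1))"
      using 2 by (intro mult_right_mono) (auto simp: y_def)
    finally show ?thesis by simp
  qed
  define C where "C = y T * sqrt (real T + 1)"
  have yC: "y t * sqrt (real t + 1) \<le> C" if "t \<ge> T" for t
    using that
  proof (induction t rule: dec_induct)
    case base
    show ?case by (simp add: C_def)
  next
    case (step n)
    show ?case using y_step[OF step.hyps(1)] step.IH by linarith
  qed
  have "(\<lambda>t. C / sqrt (real t + 1)) \<longlonglongrightarrow> 0" by real_asymp
  hence "\<forall>\<^sub>F t in sequentially. C / sqrt (real t + 1) < e"
    using order_tendstoD(2) \<open>e > 0\<close> by blast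
  then obtain T' where T': "\<And>t. t \<ge> T' \<Longrightarrow> C / sqrt (real t + 1) < e"
    unfolding eventually_sequentially by blast
  have "norm (x t - 0) < r" if "t \<ge> max T T'" for t
  proof -
    have "y t \<le> C / sqrt (real t + 1)" using yC[of t] that by (simp add: pos_le_divide_eq)
    also have "\<dots> < e" using T'[of t] that by simp
    finally have "\<bar>x t\<bar> < 2 * e" using \<open>e > 0\<close> by (simp add: y_def max_def split: if_splits)
    thus ?thesis by (simp add: e_def)
  qed
  thus "\<exists>no. \<forall>n\<ge>no. norm (x n - 0) < r" by blast
qed

text \<open>
  The limit is forced: if \<open>a t\<close> grows like \<open>L t\<close>, then comparing increments gives
  \<open>L = - \<beta> L + \<gamma>\<close>.
\<close>

lemma linear_recurrence_average_tendsto: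
  fixes a :: "nat \<Rightarrow> real"
  assumes step: "\<And>t. t \<ge> 1 \<Longrightarrow> a (Suc t) = (1 - b t / real t) * a t + g t"
    and b: "b \<longlonglongrightarrow> \<beta>" and "\<beta> \<ge> 0" and g: "g \<longlonglongrightarrow> \<gamma>"
  shows "(\<lambda>t. a t / real t) \<longlonglongrightarrow> \<gamma> / (1 + \<beta>)"
proof -
  define L where "L = \<gamma> / (1 + \<beta>)"
  have "(\<lambda>t. a t / real t - L) \<longlonglongrightarrow> 0"
  proof (rule affine_step_tendsto[OF _ b \<open>\<beta> \<ge> 0\<close>])
    have "(\<lambda>t. g t - (1 + b t) * L) \<longlonglongrightarrow> \<gamma> - (1 + \<beta>) * L"
      by (intro tendsto_intros b g)
    thus "(\<lambda>t. g t - (1 + b t) * L) \<longlonglongrightarrow> 0" using \<open>\<beta> \<ge> 0\<close> by (simp add: L_def)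
    show "a (Suc t) / real (Suc t) - L =
            (1 - (1 + b t) / (real t + 1)) * (a t / real t - L) + (g t - (1 + b t) * L) / (real t + 1)"
      if "t \<ge> 1" for t
      using that by (simp add: step[OF that] divide_simps) (simp add: algebra_simps)
  qed
  from tendsto_add[OF this tendsto_const[of L]] show ?thesis by (simp add: L_def)
qed

section \<open>Binomial weights with success probability of order 1/t\<close>

text \<open>
  The binomial probability of \<open>r\<close> successes in \<open>m\<close> trials; it vanishes for \<open>r > m\<close> because
  \<open>m choose r\<close> does.  A formula in \<open>q\<close> is used instead of \<open>binomial_pmf\<close> so that no bounds on \<open>q\<close>
  are needed.
\<close>

definition binom_weight :: "nat \<Rightarrow> real \<Rightarrow> nat \<Rightarrow> real" where
  "binom_weight m q r = real (m choose r) * q ^ r * (1 - q) ^ (m - r)"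

lemma 
  fixes q :: "nat \<Rightarrow> real"
  assumes q: "(\<lambda>t. real t * q t) \<longlonglongrightarrow> \<kappa>"
  shows binom_weight_0_tendsto: "(\<lambda>t. real t * (1 - binom_weight m (q t) 0)) \<longlonglongrightarrow> real m * \<kappa>"
    and binom_weight_pos_tendsto: "r \<ge> 1 \<Longrightarrow>
      (\<lambda>t. real t * binom_weight m (q t) r) \<longlonglongrightarrow> (if r = 1 then real m * \<kappa> else 0)"
proof -
  have "(\<lambda>t. (real t * q t) * inverse (real t)) \<longlonglongrightarrow> \<kappa> * 0"
    by (intro tendsto_mult q lim_inverse_n)
  moreover have "\<forall>\<^sub>F t in sequentially. (real t * q t) * inverse (real t) = q t"
    using eventually_gt_at_top[of 0] by eventually_elim simp
  ultimately have q0: "q \<longlonglongrightarrow> 0" using Lim_transform_eventually by fastforce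
  have "(\<lambda>t. (real t * q t) * (\<Sum>i<m. (1 - q t) ^ i)) \<longlonglongrightarrow> \<kappa> * (\<Sum>i<m. (1 - 0) ^ i)"
    by (intro tendsto_intros q q0)
  moreover have "(\<lambda>t. real t * (1 - binom_weight m (q t) 0)) = (\<lambda>t. (real t * q t) * (\<Sum>i<m. (1 - q t) ^ i))"
    using one_diff_power_eq[of "1 - q t" m for t] by (simp add: binom_weight_def mult.assoc)
  ultimately show "(\<lambda>t. real t * (1 - binom_weight m (q t) 0)) \<longlonglongrightarrow> real m * \<kappa>"
    by (simp add: mult.commute)
  assume r: "r \<ge> 1"
  have "(\<lambda>t. (real t * q t) * (real (m choose r) * q t ^ (r - 1) * (1 - q t) ^ (m - r)))
      \<longlonglongrightarrow> \<kappa> * (real (m choose r) * 0 ^ (r - 1) * (1 - 0) ^ (m - r))"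
    by (intro tendsto_intros q q0)
  moreover have "(\<lambda>t. (real t * q t) * (real (m choose r) * q t ^ (r - 1) * (1 - q t) ^ (m - r)))
      = (\<lambda>t. real t * binom_weight m (q t) r)"
    using r by (cases r) (simp_all add: binom_weight_def mult_ac)
  moreover have "\<kappa> * (real (m choose r) * 0 ^ (r - 1) * (1 - 0) ^ (m - r)) = (if r = 1 then real m * \<kappa> else 0)"
    using r by (cases "r = 1") (auto simp: power_0_left)
  ultimately show "(\<lambda>t. real t * binom_weight m (q t) r) \<longlonglongrightarrow> (if r = 1 then real m * \<kappa> else 0)"
    by simp
qed

section \<open>Attachment probabilities and the degree kernel\<close>

lemma attach_prob_sum:
  assumes "m \<ge> 1" "t \<ge> 1" and d: "(\<Sum>i=1..t. d i) = 2 * m * t"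
  shows "(\<Sum>i=1..t. attach_prob m t y (d i)) = 1"
proof -
  have *: "(\<Sum>i=1..t. real (d i)) = 2 * real m * real t"
    using arg_cong[OF d, of real] by simp
  have "real m * real t \<ge> real m * 1" using assms by (intro mult_left_mono) auto
  hence pos: "2 * real m * real t + 1 - 2 * real m > 0" by linarith
  show ?thesis
  proof (cases y)
    case True
    have "(\<Sum>i=1..t. 2 * real m * real t + 1 - real (d i)) = real t * (2 * real m * real t + 1) - 2 * real m * real t"
      using * by (simp add: sum_subtractf)
    hence "(\<Sum>i=1..t. 2 * real m * real t + 1 - real (d i)) = real t * (2 * real m * real t + 1 - 2 * real m)"
      by (simp add: algebra_simps)
    thus ?thesis using True pos assms by (simp add: attach_prob_def sum_divide_distrib[symmetric])
  next
    case False
    thus ?thesis using * assms by (simp add: attach_prob_def sum_divide_distrib[symmetric])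
  qed
qed

lemma attach_prob_tendsto:
  assumes "m \<ge> 1"
  shows "(\<lambda>t. real t * attach_prob m t y d) \<longlonglongrightarrow> (if y then 1 else real d / (2 * real m))"
proof (cases y)
  case True
  define c where "c = real m"
  have "c > 0" using assms by (simp add: c_def)
  hence "(\<lambda>t. real t * ((2 * c * real t + 1 - real d) / (real t * (2 * c * real t + 1 - 2 * c)))) \<longlonglongrightarrow> 1"
    by real_asymp
  thus ?thesis using True by (simp add: attach_prob_def c_def)
next
  case False
  have "\<forall>\<^sub>F t in sequentially. real d / (2 * real m) = real t * attach_prob m t y d"
    using eventually_gt_at_top[of 0] by eventually_elim (simp add: attach_prob_def False)
  thus ?thesis using False by (auto intro: Lim_transform_eventually[OF tendsto_const])
qed

text \<open>
  Probability that a vertex of degree \<open>d\<close> at time \<open>t\<close> receives exactly \<open>r\<close> of the \<open>m\<close> new edges,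
  averaged over the coin.
\<close>

definition degree_kernel :: "nat \<Rightarrow> real \<Rightarrow> nat \<Rightarrow> nat \<Rightarrow> nat \<Rightarrow> real" where
  "degree_kernel m p t d r = p * binom_weight m (attach_prob m t True d) r
                           + (1 - p) * binom_weight m (attach_prob m t False d) r"

text \<open>
  The limit of \<open>t\<close> times the expected number of new edges received by a vertex of degree \<open>d\<close>.
\<close>

definition attach_rate :: "nat \<Rightarrow> real \<Rightarrow> nat \<Rightarrow> real" where
  "attach_rate m p d = real m * p + (1 - p) * real d / 2"

lemma degree_kernel_0_tendsto:
  assumes "m \<ge> 1"
  shows "(\<lambda>t. real t * (1 - degree_kernel m p t d 0)) \<longlonglongrightarrow> attach_rate m p d"
proof -
  have "(\<lambda>t. p * (real t * (1 - binom_weight m (attach_prob m t True d) 0))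
         + (1 - p) * (real t * (1 - binom_weight m (attach_prob m t False d) 0)))
       \<longlonglongrightarrow> p * (real m * (if True then 1 else real d / (2 * real m)))
         + (1 - p) * (real m * (if False then 1 else real d / (2 * real m)))"
    using assms by (intro tendsto_intros binom_weight_0_tendsto attach_prob_tendsto)
  moreover have "(\<lambda>t. p * (real t * (1 - binom_weight m (attach_prob m t True d) 0))
         + (1 - p) * (real t * (1 - binom_weight m (attach_prob m t False d) 0)))
       = (\<lambda>t. real t * (1 - degree_kernel m p t d 0))"
    by (rule ext) (simp add: degree_kernel_def algebra_simps)
  moreover have "p * (real m * (if True then 1 else real d / (2 * real m)))
         + (1 - p) * (real m * (if False then 1 else real d / (2 * real m))) = attach_rate m p d"
    using assms by (simp add: attach_rate_def)
  ultimately show ?thesis by simp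
qed

lemma degree_kernel_pos_tendsto:
  assumes "m \<ge> 1" "r \<ge> 1"
  shows "(\<lambda>t. real t * degree_kernel m p t d r) \<longlonglongrightarrow> (if r = 1 then attach_rate m p d else 0)"
proof -
  have "(\<lambda>t. p * (real t * binom_weight m (attach_prob m t True d) r)
         + (1 - p) * (real t * binom_weight m (attach_prob m t False d) r))
       \<longlonglongrightarrow> p * (if r = 1 then real m * (if True then 1 else real d / (2 * real m)) else 0)
         + (1 - p) * (if r = 1 then real m * (if False then 1 else real d / (2 * real m)) else 0)"
    using assms by (intro tendsto_intros binom_weight_pos_tendsto attach_prob_tendsto)
  moreover have "(\<lambda>t. p * (real t * binom_weight m (attach_prob m t True d) r)
         + (1 - p) * (real t * binom_weight m (attach_prob m t False d) r))
       = (\<lambda>t. real t * degree_kernel m p t d r)"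
    by (rule ext) (simp add: degree_kernel_def algebra_simps)
  moreover have "p * (if r = 1 then real m * (if True then 1 else real d / (2 * real m)) else 0)
         + (1 - p) * (if r = 1 then real m * (if False then 1 else real d / (2 * real m)) else 0)
       = (if r = 1 then attach_rate m p d else 0)"
    using assms by (simp add: attach_rate_def)
  ultimately show ?thesis by simp
qed

lemma attach_rate_nonneg: "p \<in> {0..1} \<Longrightarrow> attach_rate m p d \<ge> 0"
  by (simp add: attach_rate_def)

section \<open>The limiting degree distribution\<close>

text \<open>
  The limiting degree distribution, defined by the balance equation between vertices entering and
  leaving degree \<open>k\<close>.  The recursion starts at degree 0 rather than \<open>m\<close>: the values below \<open>m\<close> are
  0 automatically, so nothing needs to be known about the minimal degree of the graph.
\<close>

fun limit_proportion :: "nat \<Rightarrow> real \<Rightarrow> nat \<Rightarrow> real" where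
  "limit_proportion m p 0 = of_bool (m = 0) / (1 + attach_rate m p 0)"
| "limit_proportion m p (Suc k) =
     (of_bool (Suc k = m) + attach_rate m p k * limit_proportion m p k) / (1 + attach_rate m p (Suc k))"

lemma limit_proportion_less: "k < m \<Longrightarrow> limit_proportion m p k = 0"
  by (induction k) auto

lemma limit_proportion_min: "limit_proportion m p m = 1 / (1 + attach_rate m p m)"
  by (cases m) (auto simp: limit_proportion_less)

lemma limit_proportion_xi:
  assumes "m \<ge> 1" "p \<ge> 0" "p < 1" "k \<ge> m"
  shows "limit_proportion m p k = 2 / (2 + real m + real m * p) * (xi m p k / xi m p m)"
  using assms(4)
proof (induction k rule: nat_induct_at_least)
  case base
  have "real m + 2 * real m * p / (1 - p) > 0" "real m + 1 + 2 * (real m * p + 1) / (1 - p) > 0"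
    using assms by (auto intro!: add_pos_nonneg divide_nonneg_pos)
  hence "xi m p m > 0" unfolding xi_def by (intro divide_pos_pos Gamma_real_pos)
  moreover have "2 + real m + real m * p > 0" "2 * (1 + attach_rate m p m) = 2 + real m + real m * p"
    using assms by (auto simp: attach_rate_def field_simps intro!: add_pos_nonneg)
  ultimately show ?case by (simp add: limit_proportion_min divide_simps)
next
  case (Suc k)
  \<comment> \<open>\<open>x\<close> and \<open>z\<close> are the arguments of the two Gamma functions in \<open>xi m p k\<close>.\<close>
  define x where "x = real k + 2 * real m * p / (1 - p)"
  define z where "z = real k + 1 + 2 * (real m * p + 1) / (1 - p)"
  have pos: "x > 0" "z > 0"
    using assms Suc.hyps by (auto simp: x_def z_def intro!: add_pos_nonneg divide_nonneg_pos)
  have rate: "attach_rate m p k = (1 - p) / 2 * x" "1 + attach_rate m p (Suc k) = (1 - p) / 2 * z"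
    using assms by (simp_all add: attach_rate_def x_def z_def field_simps)
  have "xi m p (Suc k) = Gamma (x + 1) / Gamma (z + 1)"
    by (simp add: xi_def x_def z_def add_ac)
  also have "\<dots> = x / z * (Gamma x / Gamma z)"
  proof -
    have "x \<notin> \<int>\<^sub>\<le>\<^sub>0" "z \<notin> \<int>\<^sub>\<le>\<^sub>0" using pos nonpos_Ints_nonpos by fastforce+
    thus ?thesis by (simp add: Gamma_plus1)
  qed
  also have "Gamma x / Gamma z = xi m p k" by (simp add: xi_def x_def z_def)
  finally have xi: "xi m p (Suc k) = x / z * xi m p k" .
  have "limit_proportion m p (Suc k) = x / z * limit_proportion m p k"
    using Suc.hyps assms by (simp add: rate del: of_nat_Suc)
  thus ?case by (simp add: Suc.IH xi mult_ac del: limit_proportion.simps)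
qed

lemma limit_proportion_geometric:
  assumes "m \<ge> 1" "k \<ge> m"
  shows "limit_proportion m 1 k = 1 / (real m + 1) * (1 - 1 / (real m + 1)) ^ (k - m)"
  using assms(2)
proof (induction k rule: nat_induct_at_least)
  case base
  show ?case by (simp add: limit_proportion_min attach_rate_def add_ac)
next
  case (Suc k)
  have "1 - 1 / (real m + 1) = real m / (1 + real m)" by (simp add: field_simps)
  thus ?case using Suc by (simp add: attach_rate_def Suc_diff_le)
qed

section \<open>Degrees after attaching a vertex\<close>

lemma size_filter_image_mset_set:
  "finite A \<Longrightarrow> size (filter_mset P (image_mset f (mset_set A))) = card {a \<in> A. P (f a)}"
  by (simp add: filter_mset_image_mset)

lemma degree_attach_old:
  assumes "i \<noteq> v"
  shows "degree (attach_vertex m v w H) i = degree H i + card {j \<in> {1..m}. w j = i}"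
proof -
  have "{j \<in> {1..m}. i \<in> set_uprod (Upair v (w j))} = {j \<in> {1..m}. w j = i}"
    and "{j \<in> {1..m}. Upair v (w j) = Upair i i} = {}" using assms by auto
  thus ?thesis
    unfolding degree_def attach_vertex_def
    by (simp only: multigraph.sel filter_union_mset size_union size_filter_image_mset_set finite_atLeastAtMost) simp
qed

lemma degree_attach_new:
  assumes "\<forall>j\<in>{1..m}. w j \<noteq> v"
  shows "degree (attach_vertex m v w H) v = degree H v + m"
proof -
  have "{j \<in> {1..m}. v \<in> set_uprod (Upair v (w j))} = {1..m}"
    and "{j \<in> {1..m}. Upair v (w j) = Upair v v} = {}" using assms by auto
  thus ?thesis
    unfolding degree_def attach_vertex_def
    by (simp only: multigraph.sel filter_union_mset size_union size_filter_image_mset_set finite_atLeastAtMost) simp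
qed

lemma degree_initial: "degree (initial_graph m) i = (if i = 1 then 2 * m else 0)"
  by (induction m) (auto simp: degree_def initial_graph_def)

context pa_apa begin

text \<open>
  The indices of those of the \<open>m\<close> edges added at time \<open>t + 1\<close> that end at vertex \<open>i\<close>.
\<close>

definition hits :: "nat \<Rightarrow> nat \<Rightarrow> 'a \<Rightarrow> nat set" where
  "hits t i \<omega> = {j \<in> {1..m}. W (Suc t) j \<omega> = i}"

lemma degree_Suc:
  assumes "t \<ge> 1" "\<omega> \<in> space M" "i \<noteq> Suc t"
  shows "degree (G (Suc t) \<omega>) i = degree (G t \<omega>) i + card (hits t i \<omega>)"
  using assms by (simp add: G_Suc degree_attach_old hits_def)

lemma degree_eq_0:
  assumes "t \<ge> 1" "\<omega> \<in> space M" "i \<notin> {1..t}"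
  shows "degree (G t \<omega>) i = 0"
  using assms(1,3)
proof (induction t rule: nat_induct_at_least)
  case base
  thus ?case using assms G_1 by (simp add: degree_initial)
next
  case (Suc t)
  have "hits t i \<omega> = {}" using W_range[of t _ \<omega>] Suc assms by (fastforce simp: hits_def)
  moreover have "i \<noteq> Suc t" "i \<notin> {1..t}" using Suc.prems Suc.hyps by auto
  ultimately show ?case using Suc.IH degree_Suc[OF Suc.hyps assms(2)] by simp
qed

lemma degree_new_vertex:
  assumes "t \<ge> 1" "\<omega> \<in> space M"
  shows "degree (G (Suc t) \<omega>) (Suc t) = m"
proof -
  have "\<forall>j\<in>{1..m}. W (Suc t) j \<omega> \<noteq> Suc t"
  proof
    fix j assume "j \<in> {1..m}"
    thus "W (Suc t) j \<omega> \<noteq> Suc t" using W_range[OF assms(1) _ assms(2), of j] by simp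
  qed
  from degree_attach_new[OF this] show ?thesis
    using assms degree_eq_0[of t \<omega> "Suc t"] by (simp add: G_Suc)
qed

lemma sum_degree:
  assumes "t \<ge> 1" "\<omega> \<in> space M"
  shows "(\<Sum>i=1..t. degree (G t \<omega>) i) = 2 * m * t"
  using assms(1)
proof (induction t rule: nat_induct_at_least)
  case base
  show ?case using assms G_1 by (simp add: degree_initial)
next
  case (Suc t)
  have "(\<Union>i\<in>{1..t}. hits t i \<omega>) = {1..m}"
    using W_range[of t _ \<omega>] Suc assms by (fastforce simp: hits_def)
  hence "m = card (\<Union>i\<in>{1..t}. hits t i \<omega>)" by simp
  also have "\<dots> = (\<Sum>i=1..t. card (hits t i \<omega>))"
    by (rule card_UN_disjoint) (auto simp: hits_def)
  finally have "(\<Sum>i=1..t. card (hits t i \<omega>)) = m" by simp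
  moreover have "(\<Sum>i=1..t. degree (G (Suc t) \<omega>) i) = (\<Sum>i=1..t. degree (G t \<omega>) i + card (hits t i \<omega>))"
    using Suc assms by (intro sum.cong) (auto simp: degree_Suc)
  ultimately show ?case using Suc assms degree_new_vertex[of t \<omega>]
    by (simp add: sum.distrib algebra_simps)
qed

section \<open>Measurability and independence of degrees and coins\<close>

lemma choices_in_events:
  assumes "t \<ge> 1"
  shows "{\<omega> \<in> space M. \<forall>j\<in>{1..m}. W (Suc t) j \<omega> = v j} \<in> events"
proof -
  have "{\<omega> \<in> space M. W (Suc t) j \<omega> = v j} \<in> events" if "j \<in> {1..m}" for j
  proof -
    have "W (Suc t) j -` {v j} \<inter> space M \<in> events"
      by (rule measurable_sets[OF W_measurable[OF assms that]]) simp
    thus ?thesis by (simp add: vimage_def Int_def conj_commute)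
  qed
  thus ?thesis by (intro sets.sets_Collect_finite_All) auto
qed

text \<open>
  Measurability of the graphs is not an assumption of the process: it follows because \<open>G t\<close> is a
  function of finitely many measurable choices, each with finitely many values.
\<close>

lemma G_vimage_in_events:
  assumes "t \<ge> 1"
  shows "G t -` A \<inter> space M \<in> events"
  using assms
proof (induction t arbitrary: A rule: nat_induct_at_least)
  case base
  have "G 1 -` A \<inter> space M = (if initial_graph m \<in> A then space M else {})"
    using G_1 by (auto simp del: One_nat_def)
  thus ?case by simp
next
  case (Suc t)
  have "G (Suc t) -` A \<inter> space M = (\<Union>v\<in>{1..m} \<rightarrow>\<^sub>E {1..t}.
          {\<omega> \<in> space M. \<forall>j\<in>{1..m}. W (Suc t) j \<omega> = v j} \<inter>
          (G t -` {H. attach_vertex m (Suc t) v H \<in> A} \<inter> space M))" (is "?L = ?R")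
  proof -
    have cong: "attach_vertex m (Suc t) (\<lambda>j. W (Suc t) j \<omega>) H = attach_vertex m (Suc t) v H"
      if "\<forall>j\<in>{1..m}. W (Suc t) j \<omega> = v j" for \<omega> v H
      using that by (auto simp: attach_vertex_def intro!: image_mset_cong)
    have "\<omega> \<in> ?R" if "\<omega> \<in> ?L" for \<omega>
    proof -
      let ?v = "restrict (\<lambda>j. W (Suc t) j \<omega>) {1..m}"
      have "?v \<in> {1..m} \<rightarrow>\<^sub>E {1..t}" using W_range Suc that by auto
      moreover have "attach_vertex m (Suc t) ?v (G t \<omega>) \<in> A"
      proof -
        have "attach_vertex m (Suc t) (\<lambda>j. W (Suc t) j \<omega>) (G t \<omega>) \<in> A"
          using that G_Suc[OF Suc.hyps] by auto
        thus ?thesis using cong[of \<omega> ?v "G t \<omega>"] by simp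
      qed
      moreover have "\<forall>j\<in>{1..m}. W (Suc t) j \<omega> = ?v j" by simp
      ultimately show ?thesis using that by (intro UN_I[of ?v]) blast+
    qed
    moreover have "\<omega> \<in> ?L" if R: "\<omega> \<in> ?R" for \<omega>
    proof -
      obtain v where v: "\<forall>j\<in>{1..m}. W (Suc t) j \<omega> = v j" "\<omega> \<in> space M"
        "attach_vertex m (Suc t) v (G t \<omega>) \<in> A" using R by blast
      have "G (Suc t) \<omega> = attach_vertex m (Suc t) v (G t \<omega>)"
        using G_Suc[OF Suc.hyps v(2)] cong[OF v(1)] by simp
      thus ?thesis using v by simp
    qed
    ultimately show ?thesis by (intro equalityI subsetI)
  qed
  moreover have "?R \<in> events"
    by (intro sets.finite_UN finite_PiE sets.Int[OF choices_in_events[OF Suc.hyps] Suc.IH]) auto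
  ultimately show ?case by simp
qed

lemma Y_vimage_in_events:
  assumes "t \<ge> 2"
  shows "Y t -` B \<inter> space M \<in> events"
proof -
  have "Y t \<in> measurable M (count_space UNIV)"
    using Y_indep assms unfolding indep_vars_def2 by auto
  thus ?thesis by (rule measurable_sets) simp
qed

lemma prob_Y:
  assumes "t \<ge> 2" "p \<in> {0..1}"
  shows "prob {\<omega> \<in> space M. Y t \<omega> = y} = (if y then p else 1 - p)"
proof -
  have meas: "Y t \<in> measurable M (count_space UNIV)"
    using Y_indep assms unfolding indep_vars_def2 by auto
  have "prob {\<omega> \<in> space M. Y t \<omega> = y} = measure (distr M (count_space UNIV) (Y t)) {y}"
    by (subst measure_distr[OF meas]) (auto intro!: arg_cong[where f = prob])
  also have "\<dots> = pmf (bernoulli_pmf p) y"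
    by (simp add: Y_distr[OF assms(1)] pmf.rep_eq)
  finally show ?thesis using assms by (cases y) auto
qed

lemma subalgebra_history:
  assumes "t \<ge> 1"
  shows "subalgebra M (graph_history M G t)"
proof -
  have "sigma_sets (space M) {G s -` A \<inter> space M |s A. s \<in> {1..t}} \<subseteq> events"
    by (intro sets.sigma_sets_subset) (auto intro: G_vimage_in_events)
  thus ?thesis unfolding subalgebra_def graph_history_def
    by (subst sets_measure_of) (auto simp: space_measure_of_conv)
qed

lemma subalgebra_history_with_coin:
  assumes "t \<ge> 1"
  shows "subalgebra M (history_with_coin M G Y t)"
proof -
  have sub: "sets (graph_history M G t) \<union> coin_events M (Y (Suc t)) \<subseteq> events"
    using subalgebra_history[OF assms] Y_vimage_in_events[of "Suc t"] assms
    by (auto simp: subalgebra_def coin_events_def)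
  hence "sigma_sets (space M) (sets (graph_history M G t) \<union> coin_events M (Y (Suc t))) \<subseteq> events"
    by (rule sets.sigma_sets_subset)
  thus ?thesis using sub sets.space_closed[of M] unfolding subalgebra_def history_with_coin_def
    by (subst sets_measure_of) (auto simp: space_measure_of_conv)
qed

lemma degree_event_in_history:
  assumes "t \<ge> 1"
  shows "{\<omega> \<in> space M. degree (G t \<omega>) i = d} \<in> sets (graph_history M G t)"
proof -
  have "{\<omega> \<in> space M. degree (G t \<omega>) i = d} = G t -` {H. degree H i = d} \<inter> space M" by auto
  hence "{\<omega> \<in> space M. degree (G t \<omega>) i = d} \<in> {G s -` A \<inter> space M |s A. s \<in> {1..t}}"
    using assms by (auto simp del: vimage_Collect_eq)
  thus ?thesis unfolding graph_history_def
    by (subst sets_measure_of) (auto intro: sigma_sets.Basic)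
qed

lemma coin_event: "{\<omega> \<in> space M. Y t \<omega> = y} \<in> coin_events M (Y t)"
proof -
  have "{\<omega> \<in> space M. Y t \<omega> = y} = Y t -` {y} \<inter> space M" by auto
  thus ?thesis unfolding coin_events_def by blast
qed

lemma degree_coin_event_in_history_with_coin:
  assumes "t \<ge> 1"
  shows "{\<omega> \<in> space M. degree (G t \<omega>) i = d \<and> Y (Suc t) \<omega> = y} \<in> sets (history_with_coin M G Y t)"
proof -
  have *: "sets (graph_history M G t) \<union> coin_events M (Y (Suc t)) \<subseteq> sets (history_with_coin M G Y t)"
    unfolding history_with_coin_def using sets.space_closed[of "graph_history M G t"]
    by (subst sets_measure_of)
      (auto simp: coin_events_def graph_history_def space_measure_of_conv intro!: sigma_sets.Basic)
  have "{\<omega> \<in> space M. degree (G t \<omega>) i = d} \<inter> {\<omega> \<in> space M. Y (Suc t) \<omega> = y}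
      \<in> sets (history_with_coin M G Y t)"
    using * degree_event_in_history[OF assms] coin_event by (intro sets.Int) blast+
  thus ?thesis by (simp add: Collect_conj_eq[symmetric] Int_def conj_ac cong: conj_cong)
qed

lemma prob_degree_coin:
  assumes "t \<ge> 1" "p \<in> {0..1}"
  shows "prob {\<omega> \<in> space M. degree (G t \<omega>) i = d \<and> Y (Suc t) \<omega> = y}
       = (if y then p else 1 - p) * prob {\<omega> \<in> space M. degree (G t \<omega>) i = d}"
proof -
  have "{\<omega> \<in> space M. degree (G t \<omega>) i = d \<and> Y (Suc t) \<omega> = y}
      = {\<omega> \<in> space M. degree (G t \<omega>) i = d} \<inter> {\<omega> \<in> space M. Y (Suc t) \<omega> = y}" by auto
  thus ?thesis
    using indep_setD[OF Y_indep_past[OF assms(1)] degree_event_in_history[OF assms(1)] coin_event]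
      prob_Y[of "Suc t" y] assms by simp
qed

section \<open>The conditional law of the degree increments\<close>

text \<open>
  The conditional joint law of the \<open>m\<close> choices, summed over all choices whose set of hits on \<open>i\<close> is
  \<open>S\<close>, factorises: the indices in \<open>S\<close> contribute \<open>q\<close> each and the others \<open>1 - q\<close> each, the latter
  because the attachment weights sum to 1.  After this summation the dependence on the degrees of
  the other vertices has disappeared, so the conditional probability is constant on the event that
  \<open>i\<close> has degree \<open>d\<close> and the coin shows \<open>y\<close>.
\<close>

lemma prob_degree_coin_hits_eq:
  assumes "m \<ge> 1" "t \<ge> 1" "i \<in> {1..t}" "S \<subseteq> {1..m}"
  defines "q \<equiv> \<lambda>y d. attach_prob m t y d"
  shows "prob {\<omega> \<in> space M. (degree (G t \<omega>) i = d \<and> Y (Suc t) \<omega> = y) \<and> hits t i \<omega> = S}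
       = q y d ^ card S * (1 - q y d) ^ (m - card S) *
         prob {\<omega> \<in> space M. degree (G t \<omega>) i = d \<and> Y (Suc t) \<omega> = y}"
proof -
  define F where "F = history_with_coin M G Y t"
  interpret F: finite_measure_subalgebra M F
    using subalgebra_history_with_coin[OF assms(2)] by unfold_locales (simp add: F_def)
  define E where "E = {\<omega> \<in> space M. degree (G t \<omega>) i = d \<and> Y (Suc t) \<omega> = y}"
  have EF: "E \<in> sets F"
    unfolding E_def F_def by (rule degree_coin_event_in_history_with_coin[OF assms(2)])
  hence E[measurable]: "E \<in> events" using F.subalg by (auto simp: subalgebra_def)
  \<comment> \<open>The choices of endpoints for which exactly the edges with index in \<open>S\<close> end at \<open>i\<close>.\<close>
  define V where "V = Pi\<^sub>E {1..m} (\<lambda>j. if j \<in> S then {i} else {1..t} - {i})"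
  have V_sub: "v \<in> {1..m} \<rightarrow> {1..t}" if "v \<in> V" for v
    using that assms(3) by (fastforce simp: V_def PiE_def Pi_def split: if_splits)
  have finV: "finite V" by (auto simp: V_def intro!: finite_PiE)
  define C where "C v = {\<omega> \<in> space M. \<forall>j\<in>{1..m}. W (Suc t) j \<omega> = v j}" for v
  have C[measurable]: "C v \<in> events" for v unfolding C_def by (rule choices_in_events[OF assms(2)])
  define c where "c = q y d ^ card S * (1 - q y d) ^ (m - card S)"
  have sum_const: "(\<Sum>v\<in>V. \<Prod>j\<in>{1..m}. q (Y (Suc t) \<omega>) (degree (G t \<omega>) (v j))) = c" if "\<omega> \<in> E" for \<omega>
  proof -
    have \<omega>: "\<omega> \<in> space M" "degree (G t \<omega>) i = d" "Y (Suc t) \<omega> = y" using that by (auto simp: E_def)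
    let ?q = "\<lambda>u. q y (degree (G t \<omega>) u)"
    have "(\<Sum>u=1..t. ?q u) = 1"
      unfolding q_def by (rule attach_prob_sum[OF assms(1,2) sum_degree[OF assms(2) \<omega>(1)]])
    hence rest: "(\<Sum>u\<in>{1..t} - {i}. ?q u) = 1 - q y d"
      using assms(3) \<omega> by (simp add: sum_diff1)
    have "(\<Sum>v\<in>V. \<Prod>j\<in>{1..m}. ?q (v j))
        = (\<Prod>j\<in>{1..m}. \<Sum>u\<in>(if j \<in> S then {i} else {1..t} - {i}). ?q u)"
      unfolding V_def by (subst prod_sum_PiE) auto
    also have "\<dots> = (\<Prod>j\<in>{1..m}. if j \<in> S then q y d else 1 - q y d)"
      using rest \<omega> by (intro prod.cong) auto
    also have "\<dots> = c"
      using assms(4) finite_subset[OF assms(4)]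
      by (simp add: prod.If_cases c_def card_Diff_subset Int_absorb1 Diff_eq[symmetric])
    finally show ?thesis using \<omega> by simp
  qed
  have "AE \<omega> in M. \<forall>v\<in>V. real_cond_exp M F (indicator (C v)) \<omega>
          = (\<Prod>j\<in>{1..m}. q (Y (Suc t) \<omega>) (degree (G t \<omega>) (v j)))"
    unfolding F_def C_def q_def
    by (rule AE_finite_allI[OF finV]) (rule W_cond[OF assms(2) V_sub])
  hence AE_c: "AE \<omega> in M. indicator E \<omega> *\<^sub>R (\<Sum>v\<in>V. real_cond_exp M F (indicator (C v)) \<omega>) = indicator E \<omega> *\<^sub>R c"
    by eventually_elim (auto simp: sum_const simp del: One_nat_def split: split_indicator)
  have int: "integrable M (indicator (C v) :: 'a \<Rightarrow> real)" for v
    using C by (intro integrable_real_indicator) (auto simp: less_top[symmetric])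
  have "{\<omega> \<in> space M. (degree (G t \<omega>) i = d \<and> Y (Suc t) \<omega> = y) \<and> hits t i \<omega> = S} = (\<Union>v\<in>V. E \<inter> C v)"
    (is "?L = ?R")
  proof -
    have "\<omega> \<in> ?R" if "\<omega> \<in> ?L" for \<omega>
    proof -
      let ?v = "restrict (\<lambda>j. W (Suc t) j \<omega>) {1..m}"
      have "?v \<in> V" using W_range[OF assms(2)] that unfolding V_def by (auto simp: hits_def)
      moreover have "\<omega> \<in> E \<inter> C ?v" using that by (simp add: E_def C_def)
      ultimately show ?thesis by blast
    qed
    moreover have "\<omega> \<in> ?L" if R: "\<omega> \<in> ?R" for \<omega>
    proof -
      obtain v where v: "v \<in> V" "\<omega> \<in> E" "\<omega> \<in> C v" using R by blast
      have "W (Suc t) j \<omega> = i \<longleftrightarrow> j \<in> S" if "j \<in> {1..m}" for j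
        using v that PiE_mem[OF v(1)[unfolded V_def] that] by (auto simp: C_def split: if_splits)
      hence "hits t i \<omega> = S" using assms(4) by (auto simp: hits_def)
      thus ?thesis using v by (simp add: E_def)
    qed
    ultimately show ?thesis by (intro equalityI subsetI)
  qed
  hence "prob {\<omega> \<in> space M. (degree (G t \<omega>) i = d \<and> Y (Suc t) \<omega> = y) \<and> hits t i \<omega> = S}
      = prob (\<Union>v\<in>V. E \<inter> C v)" by simp
  also have "\<dots> = (\<Sum>v\<in>V. prob (E \<inter> C v))"
  proof (rule finite_measure_finite_Union[OF finV])
    show "disjoint_family_on (\<lambda>v. E \<inter> C v) V"
      unfolding disjoint_family_on_def
    proof (intro ballI impI)
      fix v w assume "v \<in> V" "w \<in> V" "v \<noteq> w"
      then obtain j where "j \<in> {1..m}" "v j \<noteq> w j" unfolding V_def by (metis PiE_ext)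
      thus "E \<inter> C v \<inter> (E \<inter> C w) = {}" by (auto simp: C_def)
    qed
  qed auto
  also have "\<dots> = (\<Sum>v\<in>V. \<integral>\<omega>\<in>E. real_cond_exp M F (indicator (C v)) \<omega> \<partial>M)"
  proof (rule sum.cong[OF refl])
    fix v
    have "prob (E \<inter> C v) = (\<integral>\<omega>\<in>E. indicator (C v) \<omega> \<partial>M)"
      by (simp add: set_lebesgue_integral_def indicator_inter_arith[symmetric])
    thus "prob (E \<inter> C v) = (\<integral>\<omega>\<in>E. real_cond_exp M F (indicator (C v)) \<omega> \<partial>M)"
      using F.real_cond_exp_intA[OF int EF] by simp
  qed
  also have "\<dots> = (\<integral>\<omega>. indicator E \<omega> *\<^sub>R (\<Sum>v\<in>V. real_cond_exp M F (indicator (C v)) \<omega>) \<partial>M)"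
    unfolding set_lebesgue_integral_def scaleR_sum_right
    by (subst Bochner_Integration.integral_sum)
      (auto intro!: integrable_mult_indicator F.real_cond_exp_int int simp del: real_scaleR_def)
  also have "\<dots> = (\<integral>\<omega>. indicator E \<omega> *\<^sub>R c \<partial>M)"
    by (rule integral_cong_AE[OF _ _ AE_c]) auto
  also have "\<dots> = c * prob E" by simp
  finally show ?thesis by (simp add: c_def E_def)
qed

section \<open>The recursion for the expected degree counts and its limit\<close>

text \<open>
  The expected number of vertices of degree \<open>k\<close> at time \<open>t\<close>, as a sum of probabilities.
\<close>

definition expected_count :: "nat \<Rightarrow> nat \<Rightarrow> real" where
  "expected_count k t = (\<Sum>i=1..t. prob {\<omega> \<in> space M. degree (G t \<omega>) i = k})"

lemma degree_event:
  assumes "t \<ge> 1"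
  shows "{\<omega> \<in> space M. degree (G t \<omega>) i = d} \<in> events"
  using degree_event_in_history[OF assms] subalgebra_history[OF assms] by (auto simp: subalgebra_def)

lemma expected_proportion_eq:
  assumes "t \<ge> 1"
  shows "expected_proportion M G k t = expected_count k t / real t"
proof -
  have "(\<integral>\<omega>. num_degree G k t \<omega> \<partial>M) = (\<integral>\<omega>. (\<Sum>i=1..t. indicator {\<omega> \<in> space M. degree (G t \<omega>) i = k} \<omega>) \<partial>M)"
    by (rule Bochner_Integration.integral_cong) (auto simp: num_degree_def indicator_def)
  also have "\<dots> = expected_count k t"
    unfolding expected_count_def using degree_event[OF assms]
    by (subst Bochner_Integration.integral_sum)
      (auto intro!: integrable_real_indicator simp: less_top[symmetric])
  finally show ?thesis by (simp add: expected_proportion_def)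
qed

lemma hits_in_events:
  assumes "t \<ge> 1"
  shows "{\<omega> \<in> space M. hits t i \<omega> = S} \<in> events"
proof -
  have in_hits: "{\<omega> \<in> space M. j \<in> hits t i \<omega>} \<in> events" for j
  proof (cases "j \<in> {1..m}")
    case True
    have "{\<omega> \<in> space M. j \<in> hits t i \<omega>} = W (Suc t) j -` {i} \<inter> space M"
      using True by (auto simp: hits_def)
    moreover have "W (Suc t) j -` {i} \<inter> space M \<in> events"
      by (rule measurable_sets[OF W_measurable[OF assms True]]) simp
    ultimately show ?thesis by (simp only:)
  next
    case False
    hence "{\<omega> \<in> space M. j \<in> hits t i \<omega>} = {}" by (auto simp: hits_def)
    thus ?thesis by (simp only: sets.empty_sets)
  qed
  have "{\<omega> \<in> space M. (j \<in> hits t i \<omega>) = (j \<in> S)} \<in> events" for j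
  proof (cases "j \<in> S")
    case True
    thus ?thesis using in_hits[of j] by (simp only: simp_thms)
  next
    case False
    thus ?thesis using sets.sets_Collect_neg[OF in_hits[of j]] by (simp only: simp_thms)
  qed
  hence "{\<omega> \<in> space M. \<forall>j\<in>{1..m}. (j \<in> hits t i \<omega>) = (j \<in> S)} \<in> events" (is "?A \<in> _")
    by (intro sets.sets_Collect_finite_All) auto
  moreover have "{\<omega> \<in> space M. hits t i \<omega> = S} = (if S \<subseteq> {1..m} then ?A else {})"
  proof -
    have "hits t i \<omega> = S \<longleftrightarrow> S \<subseteq> {1..m} \<and> (\<forall>j\<in>{1..m}. (j \<in> hits t i \<omega>) = (j \<in> S))" for \<omega>
      unfolding hits_def by blast
    thus ?thesis by auto
  qed
  ultimately show ?thesis by (simp only: split: if_split) simp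
qed

lemma prob_degree_hits_card:
  assumes "m \<ge> 1" "p \<in> {0..1}" "t \<ge> 1" "i \<in> {1..t}"
  shows "prob {\<omega> \<in> space M. degree (G t \<omega>) i = d \<and> card (hits t i \<omega>) = r}
       = degree_kernel m p t d r * prob {\<omega> \<in> space M. degree (G t \<omega>) i = d}"
proof -
  define E where "E y S = {\<omega> \<in> space M. (degree (G t \<omega>) i = d \<and> Y (Suc t) \<omega> = y) \<and> hits t i \<omega> = S}" for y S
  define P where "P = {S. S \<subseteq> {1..m} \<and> card S = r}"
  have finP: "finite P" by (simp add: P_def)
  have E_ev: "E y S \<in> events" for y S
  proof -
    have "{\<omega> \<in> space M. degree (G t \<omega>) i = d \<and> Y (Suc t) \<omega> = y} \<in> events"
      using degree_coin_event_in_history_with_coin[OF assms(3)] subalgebra_history_with_coin[OF assms(3)]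
      by (auto simp: subalgebra_def)
    from sets.sets_Collect_conj[OF hits_in_events[OF assms(3)] this]
    show ?thesis unfolding E_def .
  qed
  have "{\<omega> \<in> space M. degree (G t \<omega>) i = d \<and> card (hits t i \<omega>) = r}
      = (\<Union>z \<in> UNIV \<times> P. E (fst z) (snd z))"
  proof -
    have "hits t i \<omega> \<subseteq> {1..m}" for \<omega> by (auto simp: hits_def)
    thus ?thesis unfolding E_def P_def by auto
  qed
  moreover have "prob (\<Union>z \<in> UNIV \<times> P. E (fst z) (snd z)) = (\<Sum>z \<in> UNIV \<times> P. prob (E (fst z) (snd z)))"
  proof (rule finite_measure_finite_Union)
    show "finite ((UNIV :: bool set) \<times> P)" using finP by simp
    show "(\<lambda>z. E (fst z) (snd z)) ` (UNIV \<times> P) \<subseteq> events" using E_ev by blast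
    show "disjoint_family_on (\<lambda>z. E (fst z) (snd z)) (UNIV \<times> P)"
      unfolding disjoint_family_on_def E_def by (auto simp: prod_eq_iff)
  qed
  ultimately have "prob {\<omega> \<in> space M. degree (G t \<omega>) i = d \<and> card (hits t i \<omega>) = r}
       = (\<Sum>(y, S) \<in> UNIV \<times> P. prob (E y S))"
    by (simp only: case_prod_unfold)
  also have "\<dots> = (\<Sum>y\<in>UNIV. \<Sum>S\<in>P. prob (E y S))"
    by (rule sum.cartesian_product[symmetric])
  also have "\<dots> = (\<Sum>y\<in>UNIV. \<Sum>S\<in>P. attach_prob m t y d ^ r * (1 - attach_prob m t y d) ^ (m - r) *
      ((if y then p else 1 - p) * prob {\<omega> \<in> space M. degree (G t \<omega>) i = d}))"
    unfolding E_def
    by (intro sum.cong refl, subst prob_degree_coin_hits_eq[OF assms(1,3,4)])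
      (auto simp: P_def prob_degree_coin[OF assms(3,2)])
  also have "\<dots> = degree_kernel m p t d r * prob {\<omega> \<in> space M. degree (G t \<omega>) i = d}"
    using n_subsets[of "{1..m}" r]
    by (simp add: UNIV_bool P_def degree_kernel_def binom_weight_def algebra_simps)
  finally show ?thesis .
qed

lemma prob_degree_Suc:
  assumes "m \<ge> 1" "p \<in> {0..1}" "t \<ge> 1" "i \<in> {1..t}"
  shows "prob {\<omega> \<in> space M. degree (G (Suc t) \<omega>) i = k}
       = (\<Sum>r\<le>k. degree_kernel m p t (k - r) r * prob {\<omega> \<in> space M. degree (G t \<omega>) i = k - r})"
proof -
  define E where "E r = {\<omega> \<in> space M. degree (G t \<omega>) i = k - r \<and> card (hits t i \<omega>) = r}" for r
  have "{\<omega> \<in> space M. card (hits t i \<omega>) = r} \<in> events" for r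
  proof -
    have "{\<omega> \<in> space M. card (hits t i \<omega>) = r} = (\<Union>S\<in>{S. S \<subseteq> {1..m} \<and> card S = r}. {\<omega> \<in> space M. hits t i \<omega> = S})"
      by (auto simp: hits_def)
    moreover have "\<dots> \<in> events"
      by (rule sets.finite_UN) (use hits_in_events[OF assms(3)] in auto)
    ultimately show ?thesis by (simp only:)
  qed
  hence E_ev: "E r \<in> events" for r
    unfolding E_def using degree_event[OF assms(3)] by (rule sets.sets_Collect_conj)
  have "{\<omega> \<in> space M. degree (G (Suc t) \<omega>) i = k} = (\<Union>r\<in>{..k}. E r)"
  proof -
    have "degree (G (Suc t) \<omega>) i = degree (G t \<omega>) i + card (hits t i \<omega>)" if "\<omega> \<in> space M" for \<omega>
      using assms(3,4) that by (intro degree_Suc) auto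
    thus ?thesis by (auto simp: E_def)
  qed
  moreover have "prob (\<Union>r\<in>{..k}. E r) = (\<Sum>r\<le>k. prob (E r))"
    by (rule finite_measure_finite_Union) (use E_ev in \<open>auto simp: disjoint_family_on_def E_def\<close>)
  ultimately have "prob {\<omega> \<in> space M. degree (G (Suc t) \<omega>) i = k} = (\<Sum>r\<le>k. prob (E r))"
    by (simp only:)
  thus ?thesis unfolding E_def prob_degree_hits_card[OF assms] .
qed

lemma expected_count_Suc:
  assumes "m \<ge> 1" "p \<in> {0..1}" "t \<ge> 1"
  shows "expected_count k (Suc t)
       = (\<Sum>r\<le>k. degree_kernel m p t (k - r) r * expected_count (k - r) t) + of_bool (k = m)"
proof -
  have "prob {\<omega> \<in> space M. degree (G (Suc t) \<omega>) (Suc t) = k} = of_bool (k = m)"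
  proof -
    have "{\<omega> \<in> space M. degree (G (Suc t) \<omega>) (Suc t) = k} = (if k = m then space M else {})"
      using degree_new_vertex[OF assms(3)] by auto
    thus ?thesis by (simp add: prob_space)
  qed
  moreover have "(\<Sum>i=1..t. prob {\<omega> \<in> space M. degree (G (Suc t) \<omega>) i = k})
      = (\<Sum>i=1..t. \<Sum>r\<le>k. degree_kernel m p t (k - r) r * prob {\<omega> \<in> space M. degree (G t \<omega>) i = k - r})"
    by (intro sum.cong refl prob_degree_Suc assms)
  moreover have "\<dots> = (\<Sum>r\<le>k. degree_kernel m p t (k - r) r * expected_count (k - r) t)"
    unfolding expected_count_def sum_distrib_left by (rule sum.swap)
  ultimately show ?thesis by (simp add: expected_count_def)
qed

lemma expected_count_average_tendsto:
  assumes "m \<ge> 1" "p \<in> {0..1}"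
  shows "(\<lambda>t. expected_count k t / real t) \<longlonglongrightarrow> limit_proportion m p k"
proof (induction k rule: less_induct)
  case (less k)
  \<comment> \<open>The \<open>r = 0\<close> term of the recursion is the linear part; the terms with \<open>r \<ge> 1\<close> involve only
    smaller degrees and converge by the induction hypothesis.\<close>
  define b where "b t = real t * (1 - degree_kernel m p t k 0)" for t
  define g where "g t = of_bool (k = m) +
    (\<Sum>r=1..k. (real t * degree_kernel m p t (k - r) r) * (expected_count (k - r) t / real t))" for t
  define \<gamma> where "\<gamma> = of_bool (k = m) +
    (\<Sum>r=1..k. (if r = 1 then attach_rate m p (k - r) else 0) * limit_proportion m p (k - r))"
  have "(\<lambda>t. expected_count k t / real t) \<longlonglongrightarrow> \<gamma> / (1 + attach_rate m p k)"
  proof (rule linear_recurrence_average_tendsto)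
    show "b \<longlonglongrightarrow> attach_rate m p k"
      unfolding b_def by (rule degree_kernel_0_tendsto[OF assms(1)])
    show "attach_rate m p k \<ge> 0" by (rule attach_rate_nonneg[OF assms(2)])
    show "g \<longlonglongrightarrow> \<gamma>"
      unfolding g_def \<gamma>_def
      by (intro tendsto_intros degree_kernel_pos_tendsto assms(1) less) auto
    fix t :: nat assume t: "t \<ge> 1"
    let ?f = "\<lambda>r. degree_kernel m p t (k - r) r * expected_count (k - r) t"
    have "{..k} = insert 0 {1..k}" by auto
    hence "(\<Sum>r\<le>k. ?f r) = ?f 0 + (\<Sum>r=1..k. ?f r)" by (simp only:) simp
    moreover have "1 - b t / real t = degree_kernel m p t k 0" using t by (simp add: b_def)
    moreover have "g t = of_bool (k = m) + (\<Sum>r=1..k. ?f r)" using t by (simp add: g_def)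
    ultimately show "expected_count k (Suc t) = (1 - b t / real t) * expected_count k t + g t"
      using expected_count_Suc[OF assms t, of k] by simp
  qed
  moreover have "\<gamma> / (1 + attach_rate m p k) = limit_proportion m p k"
  proof (cases k)
    case 0
    thus ?thesis by (auto simp: \<gamma>_def)
  next
    case (Suc n)
    have "(\<Sum>r=1..k. (if r = 1 then attach_rate m p (k - r) else 0) * limit_proportion m p (k - r))
        = (\<Sum>r\<in>{1..k}. if r = 1 then attach_rate m p (k - r) * limit_proportion m p (k - r) else 0)"
      by (intro sum.cong) auto
    also have "\<dots> = attach_rate m p n * limit_proportion m p n"
      using Suc by (subst sum.delta) auto
    finally show ?thesis using Suc by (simp add: \<gamma>_def)
  qed
  ultimately show ?case by simp
qed

lemma expected_proportion_tendsto:
  assumes "m \<ge> 1" "p \<in> {0..1}"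
  shows "expected_proportion M G k \<longlonglongrightarrow> limit_proportion m p k"
proof (rule Lim_transform_eventually[OF expected_count_average_tendsto[OF assms]])
  show "\<forall>\<^sub>F t in sequentially. expected_count k t / real t = expected_proportion M G k t"
    using eventually_ge_at_top[of 1] by eventually_elim (simp add: expected_proportion_eq)
qed

end

theorem theorem3p1:
  fixes M :: "'a measure" and m k :: nat and p :: real
    and G :: "nat \<Rightarrow> 'a \<Rightarrow> multigraph"
    and Y :: "nat \<Rightarrow> 'a \<Rightarrow> bool"
    and W :: "nat \<Rightarrow> nat \<Rightarrow> 'a \<Rightarrow> nat"
  assumes "m \<ge> 1" and "p \<in> {0..1}"
    and "pa_apa M m p G Y W"
    and "k \<ge> m"
  shows "(p < 1 \<longrightarrow>
           expected_proportion M G k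
             \<longlonglongrightarrow> 2 / (2 + real m + real m * p) * (xi m p k / xi m p m)) \<and>
         (p = 1 \<longrightarrow>
           expected_proportion M G k
             \<longlonglongrightarrow> 1 / (real m + 1) * (1 - 1 / (real m + 1)) ^ (k - m))"
proof -
  have lim: "expected_proportion M G k \<longlonglongrightarrow> limit_proportion m p k"
    by (rule pa_apa.expected_proportion_tendsto[OF assms(3,1,2)])
  show ?thesis
  proof (intro conjI impI)
    assume "p < 1"
    thus "expected_proportion M G k \<longlonglongrightarrow> 2 / (2 + real m + real m * p) * (xi m p k / xi m p m)"
      using lim limit_proportion_xi[OF assms(1) _ _ assms(4)] assms(2) by simp
  next
    assume "p = 1"
    thus "expected_proportion M G k \<longlonglongrightarrow> 1 / (real m + 1) * (1 - 1 / (real m + 1)) ^ (k - m)"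
      using lim limit_proportion_geometric[OF assms(1,4)] by simp
  qed
qed

end
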